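(* Let $a,b,c,d$ be non-zero complex numbers with $|a|^2+|b|^2=1$ and $|c|^2+|d|^2=1$. For $j=0,1$ let $$\kappa_j=\left(\frac{1+(-1)^j\sqrt{1-4|bcd|^2}}{2}\right)^{1/2},\quad |x_j\rangle=\begin{bmatrix}b^*c(\kappa_j^2-|d|^2)\\-a^*c\,\kappa_j^2\end{bmatrix},\quad |y_j\rangle=\begin{bmatrix}-a^*cd^*\\ \kappa_j^2-|d|^2\end{bmatrix}.$$ Suppose that an orthonormal basis of $\mathbb{C}^2\otimes\mathbb{C}^2$ consisting of two product states and two entangled states contains the product states $|00\rangle_{AB}$ and $a|01\rangle_{AB}+b|11\rangle_{AB}$ and the entangled state with Schmidt decomposition $$|\mathrm{ppEe}\rangle_{AB}=\sum_{j=0}^1\kappa_j\left(\frac{|x_j\rangle_A}{\||x_j\rangle\|}\right)\otimes\left(\frac{|y_j^*\rangle_B}{\||y_j\rangle\|}\right).$$ Then, up to a global phase, the other entangled state of the basis has the Schmidt decomposition $$|\mathrm{ppeE}\rangle_{AB}=\sum_{j=0}^1\kappa_j\left(\frac{|z_j\rangle_A}{\||z_j\rangle\|}\right)\otimes\left(\frac{|y_{j\oplus1}^*\rangle_B}{\||y_{j\oplus1}\rangle\|}\right),\qquad |z_j\rangle=\begin{bmatrix}b^*(\kappa_j^2-|c|^2)\\-a^*\kappa_j^2\end{bmatrix}.$$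
   Context: $|0\rangle,|1\rangle$ is the standard basis of $\mathbb{C}^2$, $|jk\rangle_{AB}=|j\rangle_A\otimes|k\rangle_B$, column vectors are with respect to the standard basis, $^*$ on scalars is complex conjugation, $|y^*\rangle$ is the entrywise complex conjugate of $|y\rangle$, and $j\oplus1$ is addition modulo 2. A state is a unit vector; a state in $\mathbb{C}^2\otimes\mathbb{C}^2$ is a product state if it equals $|u\rangle\otimes|v\rangle$, and entangled otherwise. A Schmidt decomposition of a state is an expression $\sum_j\lambda_j|u_j\rangle\otimes|v_j\rangle$ with $\lambda_j\ge 0$ and $\{|u_j\rangle\}$, $\{|v_j\rangle\}$ orthonormal families in $\mathbb{C}^2$. A global phase is a complex number of modulus one multiplying the state. *)

theory Defs
  imports "HOL-Analysis.Analysis"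
begin

text \<open>
  A qubit space is \<open>complex ^ 2\<close>, and the tensor product of two qubits is
  \<open>complex ^ (2 \<times> 2)\<close>, whose coordinates are indexed by pairs of qubit indices.
  The inner product of HOL-Analysis on these types is real-valued, so the Hermitian
  inner product is introduced here; the norm it induces is the library norm.
\<close>

type_synonym qubit = "complex ^ 2"
type_synonym two_qubit = "complex ^ (2 \<times> 2)"

definition cinner :: "complex ^ 'n \<Rightarrow> complex ^ 'n \<Rightarrow> complex" where
  "cinner x y = (\<Sum>i\<in>UNIV. cnj (x $ i) * y $ i)"

definition vec_cnj :: "complex ^ 'n \<Rightarrow> complex ^ 'n" where
  "vec_cnj x = (\<chi> i. cnj (x $ i))"

definition tensor :: "qubit \<Rightarrow> qubit \<Rightarrow> two_qubit"  (infixr \<open>\<otimes>\<close> 75) where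
  "u \<otimes> v = (\<chi> p. u $ fst p * v $ snd p)"

text \<open>The first and second coordinates (library indices 1 and 2) belong to the kets 0 and 1.\<close>

definition ket0 :: qubit where "ket0 = vector [1, 0]"
definition ket1 :: qubit where "ket1 = vector [0, 1]"

definition state :: "complex ^ 'n \<Rightarrow> bool" where
  "state \<psi> \<longleftrightarrow> norm \<psi> = 1"

definition product_state :: "two_qubit \<Rightarrow> bool" where
  "product_state \<psi> \<longleftrightarrow> state \<psi> \<and> (\<exists>u v. \<psi> = u \<otimes> v)"

definition entangled_state :: "two_qubit \<Rightarrow> bool" where
  "entangled_state \<psi> \<longleftrightarrow> state \<psi> \<and> \<not> product_state \<psi>"

definition orthonormal_family :: "nat \<Rightarrow> (nat \<Rightarrow> complex ^ 'n) \<Rightarrow> bool" where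
  "orthonormal_family n u \<longleftrightarrow>
     (\<forall>i<n. \<forall>j<n. cinner (u i) (u j) = (if i = j then 1 else 0))"

text \<open>\<open>vec.span\<close> is the complex span, with respect to the scaling \<open>(*s)\<close>.\<close>

definition orthonormal_basis :: "(complex ^ 'n) set \<Rightarrow> bool" where
  "orthonormal_basis B \<longleftrightarrow>
     (\<forall>\<psi>\<in>B. \<forall>\<phi>\<in>B. cinner \<psi> \<phi> = (if \<psi> = \<phi> then 1 else 0)) \<and> vec.span B = UNIV"

definition schmidt_decomposition ::
  "nat \<Rightarrow> two_qubit \<Rightarrow> (nat \<Rightarrow> real) \<Rightarrow> (nat \<Rightarrow> qubit) \<Rightarrow> (nat \<Rightarrow> qubit) \<Rightarrow> bool" where
  "schmidt_decomposition n \<psi> r u v \<longleftrightarrow>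
     (\<forall>j<n. r j \<ge> 0) \<and> orthonormal_family n u \<and> orthonormal_family n v \<and>
     \<psi> = (\<Sum>j<n. r j *\<^sub>R (u j \<otimes> v j))"

definition kappa :: "complex \<Rightarrow> complex \<Rightarrow> complex \<Rightarrow> nat \<Rightarrow> real" where
  "kappa b c d j = sqrt ((1 + (-1) ^ j * sqrt (1 - 4 * (cmod (b * c * d))\<^sup>2)) / 2)"

definition x_vec :: "complex \<Rightarrow> complex \<Rightarrow> complex \<Rightarrow> complex \<Rightarrow> nat \<Rightarrow> qubit" where
  "x_vec a b c d j =
     vector [cnj b * c * of_real ((kappa b c d j)\<^sup>2 - (cmod d)\<^sup>2),
             - cnj a * c * of_real ((kappa b c d j)\<^sup>2)]"

definition y_vec :: "complex \<Rightarrow> complex \<Rightarrow> complex \<Rightarrow> complex \<Rightarrow> nat \<Rightarrow> qubit" where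
  "y_vec a b c d j =
     vector [- cnj a * c * cnj d,
             of_real ((kappa b c d j)\<^sup>2 - (cmod d)\<^sup>2)]"

definition z_vec :: "complex \<Rightarrow> complex \<Rightarrow> complex \<Rightarrow> complex \<Rightarrow> nat \<Rightarrow> qubit" where
  "z_vec a b c d j =
     vector [cnj b * of_real ((kappa b c d j)\<^sup>2 - (cmod c)\<^sup>2),
             - cnj a * of_real ((kappa b c d j)\<^sup>2)]"

end

theory Submission
  imports Defs
begin

text \<open>
  Read a two-qubit vector as a \<open>2 \<times> 2\<close> matrix \<open>\<psi>\<close>. If the \<open>v\<^sub>j\<close> are orthonormal, then \<open>\<psi>\<close> is
  the sum of the tensors of \<open>\<psi> v\<^sub>j\<^sup>*\<close> with \<open>v\<^sub>j\<close>, so a Schmidt decomposition can be read off from the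
  images of the \<open>v\<^sub>j\<^sup>*\<close>. The matrix \<open>M\<close> with rows \<open>(0, c b\<^sup>*)\<close> and \<open>(d, - c a\<^sup>*)\<close> satisfies
  \<open>M y\<^sub>j = x\<^sub>j\<close> and \<open>\<parallel>x\<^sub>j\<parallel> = \<kappa>\<^sub>j \<parallel>y\<^sub>j\<parallel>\<close>, hence is the given entangled state. A unit vector orthogonal to
  it and to both product states is, up to a phase, the matrix \<open>N\<close> with rows \<open>(0, d\<^sup>* b\<^sup>*)\<close> and
  \<open>(- c\<^sup>*, - d\<^sup>* a\<^sup>*)\<close>, and \<open>N\<close> maps \<open>y\<^bsub>j \<oplus> 1\<^esub>\<close> to \<open>- d\<^sup>* z\<^sub>j\<close>. The factor \<open>- d\<^sup>* / |d|\<close> is the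
  phase to be removed.
\<close>

section \<open>Coordinates, inner products and norms\<close>

lemma sum_UNIV_2x2: "(\<Sum>p\<in>UNIV. f (p :: 2 \<times> 2)) = f (1,1) + f (1,2) + f (2,1) + f (2,2)"
proof -
  have "(\<Sum>p\<in>UNIV. f p) = (\<Sum>i\<in>UNIV. \<Sum>l\<in>UNIV. f (i, l))"
    by (simp add: UNIV_Times_UNIV[symmetric] sum.cartesian_product del: UNIV_Times_UNIV)
  then show ?thesis by (simp add: sum_2 add.assoc)
qed

lemma two_qubit_eq_iff:
  fixes \<psi> \<phi> :: two_qubit
  shows "\<psi> = \<phi> \<longleftrightarrow> (\<forall>i l. \<psi> $ (i, l) = \<phi> $ (i, l))"
  by (auto simp: vec_eq_iff)

lemma cnj_mult_self: "cnj z * z = of_real ((cmod z)\<^sup>2)"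
  by (metis complex_norm_square mult.commute)

lemma cinner_self: "cinner x x = of_real ((norm x)\<^sup>2)"
  by (simp add: cinner_def cnj_mult_self norm_vec_def L2_set_def sum_nonneg)

lemma cinner_scaleR: "cinner (r *\<^sub>R x) (s *\<^sub>R y) = of_real (r * s) * cinner x y"
  by (simp add: cinner_def sum_distrib_left scaleR_conv_of_real[where ?'a=complex] algebra_simps)

lemma cinner_qubit: "cinner x (y :: qubit) = cnj (x $ 1) * y $ 1 + cnj (x $ 2) * y $ 2"
  by (simp add: cinner_def sum_2)

lemma norm_sq_qubit: "(norm (x :: qubit))\<^sup>2 = (cmod (x $ 1))\<^sup>2 + (cmod (x $ 2))\<^sup>2"
  by (simp add: norm_vec_def L2_set_def sum_2)

lemma norm_sq_two_qubit:
  "(norm (x :: two_qubit))\<^sup>2 = (cmod (x $ (1,1)))\<^sup>2 + (cmod (x $ (1,2)))\<^sup>2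
     + (cmod (x $ (2,1)))\<^sup>2 + (cmod (x $ (2,2)))\<^sup>2"
  by (simp add: norm_vec_def L2_set_def sum_UNIV_2x2)

lemma norm_vec_cnj [simp]: "norm (vec_cnj x) = norm x"
  by (simp add: norm_vec_def vec_cnj_def)

lemma vec_cnj_scaleR: "vec_cnj (r *\<^sub>R x) = r *\<^sub>R vec_cnj x"
  by (simp add: vec_cnj_def vec_eq_iff)

lemma vec_cnj_vec_cnj [simp]: "vec_cnj (vec_cnj x) = x"
  by (simp add: vec_cnj_def vec_eq_iff)

section \<open>Schmidt sums from contractions\<close>

lemma orthonormal_family_resolution:
  fixes v :: "nat \<Rightarrow> qubit"
  assumes "orthonormal_family 2 v"
  shows "(\<Sum>j<2. cnj (v j $ k) * v j $ l) = (if k = l then 1 else 0)"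
proof -
  \<comment> \<open>The rows of \<open>V\<close> are \<open>v 0\<close> and \<open>v 1\<close>, and
    \<open>W\<close> is its conjugate transpose. Matrix index 1 stands for family index 0, since the
    type \<open>2\<close> is numbered from 1.\<close>
  define V :: "complex ^ 2 ^ 2" where "V = (\<chi> k l. v (if k = 1 then 0 else 1) $ l)"
  define W :: "complex ^ 2 ^ 2" where "W = (\<chi> k l. cnj (v (if l = 1 then 0 else 1) $ k))"
  have o: "cnj (v i $ 1) * v j $ 1 + cnj (v i $ 2) * v j $ 2 = (if i = j then 1 else 0)"
    if "i < 2" "j < 2" for i j
    using assms that by (simp add: orthonormal_family_def cinner_qubit)
  have "V ** W = mat 1"
    using o[of 0 0] o[of 0 1] o[of 1 0] o[of 1 1]
    by (simp add: matrix_matrix_mult_def mat_def vec_eq_iff V_def W_def sum_2 forall_2 mult.commute)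
  \<comment> \<open>A right inverse of a square matrix is also a left inverse; this turns
    orthonormality into completeness.\<close>
  then have "W ** V = mat 1"
    using matrix_left_right_inverse by blast
  then have "(W ** V) $ k $ l = mat 1 $ k $ l" by simp
  then show ?thesis
    by (simp add: matrix_matrix_mult_def mat_def V_def W_def sum_2 lessThan_Suc numeral_2_eq_2 add.commute)
qed

text \<open>The matrix-vector product for the matrix reading of \<open>\<psi>\<close>. It is linear
  in \<open>v\<close>, so expanding along \<open>v j\<close> means contracting with the conjugate of
  \<open>v j\<close>.\<close>

definition contract :: "two_qubit \<Rightarrow> qubit \<Rightarrow> qubit" where
  "contract \<psi> v = (\<chi> i. \<Sum>l\<in>UNIV. \<psi> $ (i, l) * v $ l)"

lemma contract_scaleR: "contract \<psi> (r *\<^sub>R v) = r *\<^sub>R contract \<psi> v"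
  by (simp add: contract_def vec_eq_iff scaleR_right.sum)

lemma sum_contract_tensor:
  assumes "orthonormal_family 2 v"
  shows "(\<Sum>j<2. contract \<psi> (vec_cnj (v j)) \<otimes> v j) = \<psi>"
proof -
  have "(\<Sum>j<2. contract \<psi> (vec_cnj (v j)) \<otimes> v j) $ (i, l) = \<psi> $ (i, l)" for i l
  proof -
    have "(\<Sum>j<2. contract \<psi> (vec_cnj (v j)) \<otimes> v j) $ (i, l)
        = (\<Sum>j<2. \<Sum>k\<in>UNIV. \<psi> $ (i, k) * (cnj (v j $ k) * v j $ l))"
      by (simp add: contract_def tensor_def vec_cnj_def sum_distrib_right mult.assoc)
    also have "\<dots> = (\<Sum>k\<in>UNIV. \<psi> $ (i, k) * (\<Sum>j<2. cnj (v j $ k) * v j $ l))"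
      by (subst sum.swap) (simp only: sum_distrib_left)
    also have "\<dots> = \<psi> $ (i, l)"
      by (simp add: orthonormal_family_resolution[OF assms] if_distrib[of "(*) _"] cong: if_cong)
    finally show ?thesis .
  qed
  then show ?thesis by (simp add: two_qubit_eq_iff)
qed

text \<open>The common factor \<open>t\<close> allows the images to be a multiple of the desired
  vectors: 1 for the given entangled state, |d| for the other one. By \<open>len\<close> the
  normalized \<open>y j\<close> has image \<open>r j\<close> times the normalized
  \<open>x j\<close>.\<close>

lemma schmidt_sum_eqI:
  fixes x y :: "nat \<Rightarrow> qubit"
  assumes orth: "orthonormal_family 2 (\<lambda>j. vec_cnj (y j) /\<^sub>R norm (y j))"
    and img: "\<And>j. j < 2 \<Longrightarrow> contract \<psi> (y j) = t *\<^sub>R x j"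
    and len: "\<And>j. j < 2 \<Longrightarrow> t * norm (x j) = r j * norm (y j)"
    and nz: "\<And>j. j < 2 \<Longrightarrow> x j \<noteq> 0" "\<And>j. j < 2 \<Longrightarrow> y j \<noteq> 0"
  shows "(\<Sum>j<2. r j *\<^sub>R ((x j /\<^sub>R norm (x j)) \<otimes> (vec_cnj (y j) /\<^sub>R norm (y j)))) = \<psi>"
proof -
  have "r j *\<^sub>R ((x j /\<^sub>R norm (x j)) \<otimes> w) = contract \<psi> (y j /\<^sub>R norm (y j)) \<otimes> w"
    if j: "j < 2" for j w
  proof -
    have "r j / norm (x j) = t / norm (y j)"
      using len[OF j] nz[OF j] by (simp add: field_simps)
    then have "r j *\<^sub>R (x j /\<^sub>R norm (x j)) = contract \<psi> (y j /\<^sub>R norm (y j))"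
      by (simp add: contract_scaleR img[OF j] divide_inverse mult.commute)
    moreover have "r j *\<^sub>R ((x j /\<^sub>R norm (x j)) \<otimes> w) = (r j *\<^sub>R (x j /\<^sub>R norm (x j))) \<otimes> w"
      by (simp add: tensor_def vec_eq_iff)
    ultimately show ?thesis by simp
  qed
  then show ?thesis
    using sum_contract_tensor[OF orth, of \<psi>] by (simp add: vec_cnj_scaleR)
qed

lemma orthonormal_family_2I:
  assumes "cinner (u 0) (u 0) = 1" "cinner (u 1) (u 1) = 1" "cinner (u 0) (u 1) = 0"
  shows "orthonormal_family 2 u"
proof -
  have "cinner (u 1) (u 0) = cnj (cinner (u 0) (u 1))"
    by (simp add: cinner_def mult.commute)
  with assms show ?thesis
    by (auto simp: orthonormal_family_def less_2_cases_iff)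
qed

lemma orthonormal_family_normalizedI:
  assumes "u 0 \<noteq> 0" "u 1 \<noteq> 0" "cinner (u 0) (u 1) = 0"
  shows "orthonormal_family 2 (\<lambda>j. u j /\<^sub>R norm (u j))"
  using assms
  by (intro orthonormal_family_2I) (simp_all add: cinner_scaleR cinner_self power2_eq_square)

lemma orthonormal_family_swap:
  assumes "orthonormal_family 2 u"
  shows "orthonormal_family 2 (\<lambda>j. u ((j + 1) mod 2))"
  using assms by (auto simp: orthonormal_family_def less_2_cases_iff)

section \<open>Identities for the Schmidt coefficients and vectors\<close>

context
  fixes a b c d :: complex
  assumes nonzero: "a \<noteq> 0" "b \<noteq> 0" "c \<noteq> 0" "d \<noteq> 0"
    and ab: "(cmod a)\<^sup>2 + (cmod b)\<^sup>2 = 1"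
    and cd: "(cmod c)\<^sup>2 + (cmod d)\<^sup>2 = 1"
begin

text \<open>Since |c|^2 + |d|^2 = 1, the product 4|c|^2|d|^2 is at most 1, and |b| is at most 1.
  Hence the inner root of \<open>kappa\<close> squares back to its argument.\<close>

lemma discriminant_nonneg: "0 \<le> 1 - 4 * (cmod (b * c * d))\<^sup>2"
proof -
  have B: "(cmod b)\<^sup>2 \<le> 1" using ab zero_le_power2[of "cmod a"] by linarith
  have "0 \<le> ((cmod c)\<^sup>2 - (cmod d)\<^sup>2)\<^sup>2" by simp
  also have "\<dots> = ((cmod c)\<^sup>2 + (cmod d)\<^sup>2)\<^sup>2 - 4 * ((cmod c)\<^sup>2 * (cmod d)\<^sup>2)"
    by algebra
  finally have CD: "4 * ((cmod c)\<^sup>2 * (cmod d)\<^sup>2) \<le> 1" by (simp add: cd)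
  have "(cmod b)\<^sup>2 * (4 * ((cmod c)\<^sup>2 * (cmod d)\<^sup>2)) \<le> 1"
    by (rule mult_le_one[OF B _ CD]) simp
  then show ?thesis by (simp add: norm_mult power_mult_distrib algebra_simps)
qed

lemma kappa_sq: "(kappa b c d j)\<^sup>2 = (1 + (-1) ^ j * sqrt (1 - 4 * (cmod (b * c * d))\<^sup>2)) / 2"
proof -
  have "sqrt (1 - 4 * (cmod (b * c * d))\<^sup>2) \<le> 1" by (simp add: real_sqrt_le_1_iff)
  then have "0 \<le> (1 + (-1) ^ j * sqrt (1 - 4 * (cmod (b * c * d))\<^sup>2)) / 2"
    using discriminant_nonneg by (cases "even j") auto
  then show ?thesis by (simp add: kappa_def)
qed

text \<open>The squares of \<open>kappa\<close> are the roots of k^2 - k + |bcd|^2. The norm and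
  orthogonality computations below work with this equation instead of the radicals.\<close>

lemma kappa_sq_quadratic:
  "(kappa b c d j)\<^sup>2 * (1 - (kappa b c d j)\<^sup>2) = (cmod b)\<^sup>2 * (cmod c)\<^sup>2 * (cmod d)\<^sup>2"
proof -
  define s where "s = sqrt (1 - 4 * (cmod (b * c * d))\<^sup>2)"
  have "s\<^sup>2 = 1 - 4 * ((cmod b)\<^sup>2 * (cmod c)\<^sup>2 * (cmod d)\<^sup>2)"
    using discriminant_nonneg by (simp add: s_def norm_mult power_mult_distrib)
  then have "((-1) ^ j * s)\<^sup>2 = 1 - 4 * ((cmod b)\<^sup>2 * (cmod c)\<^sup>2 * (cmod d)\<^sup>2)"
    by (simp add: power_mult_distrib power_mult[symmetric])
  then show ?thesis
    unfolding kappa_sq s_def[symmetric] by (simp add: field_simps power2_eq_square)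
qed

lemma kappa_sq_swap:
  "j < 2 \<Longrightarrow> (kappa b c d ((j + 1) mod 2))\<^sup>2 = 1 - (kappa b c d j)\<^sup>2"
  by (auto simp: kappa_sq less_2_cases_iff field_simps)

lemma kappa_pos: "0 < kappa b c d j"
proof -
  have "kappa b c d j \<noteq> 0" using kappa_sq_quadratic[of j] nonzero by auto
  moreover have "0 \<le> kappa b c d j"
    using kappa_sq[of j] unfolding kappa_def by (metis real_sqrt_ge_zero zero_le_power2)
  ultimately show ?thesis by simp
qed

text \<open>Substituting k(1 - k) for BCD reduces both sides to k(2k^2 - k - 2Ck + C). For z the
  values of C and D are |c|^2 and |d|^2; for x they are exchanged.\<close>

lemma kappa_norm_identity:
  fixes A B C D k :: real
  assumes "A + B = 1" "C + D = 1" "k * (1 - k) = B * C * D"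
  shows "D * (B * (k - C)\<^sup>2 + A * k\<^sup>2) = k * (A * C * D + (k - C)\<^sup>2)"
  using assms by algebra

lemma x_vec_nonzero: "x_vec a b c d j \<noteq> 0"
  using nonzero kappa_pos[of j] by (auto simp: x_vec_def vec_eq_iff forall_2)

lemma y_vec_nonzero: "y_vec a b c d j \<noteq> 0"
  using nonzero by (auto simp: y_vec_def vec_eq_iff forall_2)

lemma z_vec_nonzero: "z_vec a b c d j \<noteq> 0"
  using nonzero kappa_pos[of j] by (auto simp: z_vec_def vec_eq_iff forall_2)

lemma norm_x_vec: "norm (x_vec a b c d j) = kappa b c d j * norm (y_vec a b c d j)"
proof -
  have "(norm (x_vec a b c d j))\<^sup>2
      = (cmod c)\<^sup>2 * ((cmod b)\<^sup>2 * ((kappa b c d j)\<^sup>2 - (cmod d)\<^sup>2)\<^sup>2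
          + (cmod a)\<^sup>2 * ((kappa b c d j)\<^sup>2)\<^sup>2)"
    by (simp add: norm_sq_qubit x_vec_def norm_mult power_mult_distrib distrib_left mult_ac
        del: of_real_diff of_real_power)
  also have "\<dots> = (kappa b c d j)\<^sup>2 * ((cmod a)\<^sup>2 * (cmod d)\<^sup>2 * (cmod c)\<^sup>2
      + ((kappa b c d j)\<^sup>2 - (cmod d)\<^sup>2)\<^sup>2)"
    by (rule kappa_norm_identity[OF ab]) (use cd kappa_sq_quadratic[of j] in simp_all)
  also have "\<dots> = (kappa b c d j * norm (y_vec a b c d j))\<^sup>2"
    by (simp add: norm_sq_qubit y_vec_def norm_mult power_mult_distrib mult_ac
        del: of_real_diff of_real_power)
  finally show ?thesis
    using kappa_pos[of j] by (simp add: power2_eq_iff_nonneg)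
qed

lemma norm_z_vec:
  assumes "j < 2"
  shows "cmod d * norm (z_vec a b c d j) = kappa b c d j * norm (y_vec a b c d ((j + 1) mod 2))"
proof -
  have D: "(cmod d)\<^sup>2 = 1 - (cmod c)\<^sup>2" using cd by simp
  \<comment> \<open>This sign flip is why \<open>z_vec\<close> at j is paired with
    \<open>y_vec\<close> at the other index.\<close>
  have e: "1 - (kappa b c d j)\<^sup>2 - (cmod d)\<^sup>2 = - ((kappa b c d j)\<^sup>2 - (cmod c)\<^sup>2)"
    using cd by simp
  have "(cmod d * norm (z_vec a b c d j))\<^sup>2
      = (cmod d)\<^sup>2 * ((cmod b)\<^sup>2 * ((kappa b c d j)\<^sup>2 - (cmod c)\<^sup>2)\<^sup>2
          + (cmod a)\<^sup>2 * ((kappa b c d j)\<^sup>2)\<^sup>2)"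
    by (simp add: norm_sq_qubit z_vec_def norm_mult power_mult_distrib
        del: of_real_diff of_real_power)
  also have "\<dots> = (kappa b c d j)\<^sup>2 * ((cmod a)\<^sup>2 * (cmod c)\<^sup>2 * (cmod d)\<^sup>2
      + ((kappa b c d j)\<^sup>2 - (cmod c)\<^sup>2)\<^sup>2)"
    by (rule kappa_norm_identity[OF ab cd kappa_sq_quadratic])
  also have "\<dots> = (kappa b c d j * norm (y_vec a b c d ((j + 1) mod 2)))\<^sup>2"
    by (simp add: norm_sq_qubit y_vec_def kappa_sq_swap[OF assms, simplified] e norm_mult
        power_mult_distrib power2_commute[of "(cmod c)\<^sup>2"] del: of_real_diff of_real_power)
  finally show ?thesis
    using kappa_pos[of j] by (simp add: power2_eq_iff_nonneg)
qed

lemma z_vec_orthogonal: "cinner (z_vec a b c d 0) (z_vec a b c d 1) = 0"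
proof -
  define k where "k = (kappa b c d 0)\<^sup>2"
  have k1: "(kappa b c d 1)\<^sup>2 = 1 - k" using kappa_sq_swap[of 0] by (simp add: k_def)
  have "cinner (z_vec a b c d 0) (z_vec a b c d 1)
      = (cnj b * b) * of_real ((k - (cmod c)\<^sup>2) * (1 - k - (cmod c)\<^sup>2))
        + (cnj a * a) * of_real (k * (1 - k))"
    by (simp add: cinner_qubit z_vec_def k1[simplified] k_def[symmetric])
  also have "\<dots> = of_real ((cmod b)\<^sup>2 * ((k - (cmod c)\<^sup>2) * (1 - k - (cmod c)\<^sup>2))
      + (cmod a)\<^sup>2 * (k * (1 - k)))"
    by (simp only: cnj_mult_self of_real_mult of_real_add)
  \<comment> \<open>The left side simplifies to k(1 - k) - |b|^2|c|^2|d|^2.\<close>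
  also have "(cmod b)\<^sup>2 * ((k - (cmod c)\<^sup>2) * (1 - k - (cmod c)\<^sup>2)) + (cmod a)\<^sup>2 * (k * (1 - k)) = 0"
    using ab cd kappa_sq_quadratic[of 0, folded k_def] by algebra
  finally show ?thesis by simp
qed

section \<open>Matrix form of the two entangled states\<close>

definition first_ent :: two_qubit where
  "first_ent = (c * cnj b) *s (ket0 \<otimes> ket1) + d *s (ket1 \<otimes> ket0) - (c * cnj a) *s (ket1 \<otimes> ket1)"

definition second_ent :: two_qubit where
  "second_ent = (cnj d * cnj b) *s (ket0 \<otimes> ket1) - cnj c *s (ket1 \<otimes> ket0)
     - (cnj d * cnj a) *s (ket1 \<otimes> ket1)"

lemma contract_first_ent: "contract first_ent (y_vec a b c d j) = x_vec a b c d j"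
proof -
  have "d * cnj d = of_real ((cmod d)\<^sup>2)" by (rule complex_norm_square[symmetric])
  then show ?thesis
    by (simp add: contract_def first_ent_def tensor_def ket0_def ket1_def y_vec_def x_vec_def
        vec_eq_iff forall_2 sum_2) algebra
qed

lemma contract_second_ent:
  assumes "j < 2"
  shows "contract second_ent (y_vec a b c d ((j + 1) mod 2)) = (- cnj d) *s z_vec a b c d j"
proof -
  have "c * cnj c = of_real ((cmod c)\<^sup>2)" by (rule complex_norm_square[symmetric])
  moreover have "complex_of_real ((cmod d)\<^sup>2) = 1 - of_real ((cmod c)\<^sup>2)"
    using cd by (metis add_diff_cancel_left' of_real_1 of_real_diff)
  ultimately show ?thesis
    by (simp add: contract_def second_ent_def tensor_def ket0_def ket1_def y_vec_def z_vec_def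
        vec_eq_iff forall_2 sum_2 kappa_sq_swap[OF assms, simplified]) algebra
qed

text \<open>The orthogonality conditions are three linear equations in four coordinates, with
  solution line spanned by \<open>second_ent\<close>; the norm leaves only a phase.\<close>

lemma orthogonal_complement_unique:
  assumes "cinner (ket0 \<otimes> ket0) \<psi> = 0"
    and "cinner (a *s (ket0 \<otimes> ket1) + b *s (ket1 \<otimes> ket1)) \<psi> = 0"
    and "cinner first_ent \<psi> = 0"
    and "norm \<psi> = 1"
  shows "\<exists>\<omega>. cmod \<omega> = 1 \<and> \<psi> = \<omega> *s second_ent"
proof -
  have e11: "\<psi> $ (1,1) = 0"
    and e1: "cnj a * \<psi> $ (1,2) + cnj b * \<psi> $ (2,2) = 0"
    and e2: "cnj c * b * \<psi> $ (1,2) + cnj d * \<psi> $ (2,1) - cnj c * a * \<psi> $ (2,2) = 0"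
    using assms(1-3)
    by (simp_all add: cinner_def sum_UNIV_2x2 first_ent_def tensor_def ket0_def ket1_def)
  have AB: "cnj a * a + cnj b * b = 1"
    using ab by (metis cnj_mult_self of_real_1 of_real_add)
  \<comment> \<open>For \<open>second_ent\<close> itself the numerator is d*(|a|^2 + |b|^2) = d*, so
    \<open>t\<close> recovers the scalar.\<close>
  define t where "t = (b * \<psi> $ (1,2) - a * \<psi> $ (2,2)) / cnj d"
  have td: "t * cnj d = b * \<psi> $ (1,2) - a * \<psi> $ (2,2)" using nonzero by (simp add: t_def)
  \<comment> \<open>\<open>e1\<close> and \<open>td\<close> form a 2 by 2 system whose determinant
    is -1 by \<open>AB\<close>.\<close>
  have f12: "\<psi> $ (1,2) = t * cnj d * cnj b"
    unfolding td using e1 AB by algebra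
  have f22: "\<psi> $ (2,2) = - (t * cnj d * cnj a)"
    unfolding td using e1 AB by algebra
  have "cnj d * (\<psi> $ (2,1) + t * cnj c) = 0"
    using e2 td by algebra
  then have f21: "\<psi> $ (2,1) = - (t * cnj c)"
    using nonzero by (simp add: add_eq_0_iff2)
  have "1 = (cmod t)\<^sup>2 * ((cmod c)\<^sup>2 + (cmod d)\<^sup>2 * ((cmod a)\<^sup>2 + (cmod b)\<^sup>2))"
    using norm_sq_two_qubit[of \<psi>] assms(4)
    by (simp add: e11 f12 f21 f22 norm_mult power_mult_distrib algebra_simps)
  then have "(cmod t)\<^sup>2 = 1" by (simp add: ab cd)
  then have "cmod t = 1" using power2_eq_iff_nonneg[of "cmod t" 1] by simp
  moreover have "\<psi> = t *s second_ent"
    by (simp add: vec_eq_iff forall_2 e11 f12 f21 f22 second_ent_def tensor_def ket0_def ket1_def)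
  ultimately show ?thesis by blast
qed

end

theorem theorem16:
  fixes a b c d :: complex
    and B :: "two_qubit set"
    and ppEe ppeE :: two_qubit
  assumes nonzero: "a \<noteq> 0" "b \<noteq> 0" "c \<noteq> 0" "d \<noteq> 0"
    and ab: "(cmod a)\<^sup>2 + (cmod b)\<^sup>2 = 1"
    and cd: "(cmod c)\<^sup>2 + (cmod d)\<^sup>2 = 1"
    and basis: "orthonormal_basis B"
    and two_product: "card {\<psi> \<in> B. product_state \<psi>} = 2"
    and two_entangled: "card {\<psi> \<in> B. entangled_state \<psi>} = 2"
    and first_product: "ket0 \<otimes> ket0 \<in> B"
    and second_product: "a *s (ket0 \<otimes> ket1) + b *s (ket1 \<otimes> ket1) \<in> B"
    and first_entangled: "ppEe \<in> B" "entangled_state ppEe"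
    and first_schmidt:
      "schmidt_decomposition 2 ppEe (kappa b c d)
         (\<lambda>j. x_vec a b c d j /\<^sub>R norm (x_vec a b c d j))
         (\<lambda>j. vec_cnj (y_vec a b c d j) /\<^sub>R norm (y_vec a b c d j))"
    and other_entangled: "ppeE \<in> B" "entangled_state ppeE" "ppeE \<noteq> ppEe"
  shows "\<exists>\<omega>. cmod \<omega> = 1 \<and>
      schmidt_decomposition 2 (\<omega> *s ppeE) (kappa b c d)
        (\<lambda>j. z_vec a b c d j /\<^sub>R norm (z_vec a b c d j))
        (\<lambda>j. vec_cnj (y_vec a b c d ((j + 1) mod 2)) /\<^sub>R norm (y_vec a b c d ((j + 1) mod 2)))"
proof -
  let ?x = "x_vec a b c d" and ?y = "y_vec a b c d" and ?z = "z_vec a b c d"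
    and ?\<kappa> = "kappa b c d"
  have y_orth: "orthonormal_family 2 (\<lambda>j. vec_cnj (?y j) /\<^sub>R norm (?y j))"
    and ppEe_sum: "ppEe = (\<Sum>j<2. ?\<kappa> j *\<^sub>R ((?x j /\<^sub>R norm (?x j)) \<otimes> (vec_cnj (?y j) /\<^sub>R norm (?y j))))"
    using first_schmidt by (simp_all add: schmidt_decomposition_def)
  have ppEe: "ppEe = first_ent a b c d"
    unfolding ppEe_sum
    by (rule schmidt_sum_eqI[OF y_orth, where t = 1])
      (simp_all add: contract_first_ent[OF nonzero ab cd] norm_x_vec[OF nonzero ab cd]
        x_vec_nonzero[OF nonzero ab cd] y_vec_nonzero[OF nonzero ab cd])
  have orth: "cinner \<phi> ppeE = 0" if "\<phi> \<in> B" "\<phi> \<noteq> ppeE" for \<phi>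
    using basis that other_entangled(1) by (auto simp: orthonormal_basis_def)
  have unit: "norm ppeE = 1" and not_tensor: "ppeE \<noteq> u \<otimes> v" for u v
    using other_entangled(2) by (auto simp: entangled_state_def product_state_def state_def)
  \<comment> \<open>Being a tensor, this vector differs from the entangled \<open>ppeE\<close>; so
    does |00>. Distinct basis elements are orthogonal.\<close>
  have "a *s (ket0 \<otimes> ket1) + b *s (ket1 \<otimes> ket1) = (a *s ket0 + b *s ket1) \<otimes> ket1"
    by (simp add: vec_eq_iff tensor_def algebra_simps)
  then obtain \<omega> where \<omega>: "cmod \<omega> = 1" "ppeE = \<omega> *s second_ent a b c d"
    using orthogonal_complement_unique[OF nonzero ab cd, of ppeE] orth not_tensor unit
      first_product second_product first_entangled(1) other_entangled(3) ppEe
    by metis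
  \<comment> \<open>Chosen to turn the factor -d* in the contraction of \<open>second_ent\<close>
    into the positive real |d|. Dividing by \<open>\<omega>\<close> as well removes the unknown
    phase of \<open>ppeE\<close>.\<close>
  define \<eta> where "\<eta> = - (of_real (cmod d) / cnj d)"
  have \<eta>: "cmod \<eta> = 1" "\<eta> * - cnj d = of_real (cmod d)"
    using nonzero by (simp_all add: \<eta>_def norm_divide)
  have \<omega>_nz: "\<omega> \<noteq> 0" using \<omega>(1) by auto
  then have rephased: "(\<eta> / \<omega>) *s ppeE = \<eta> *s second_ent a b c d"
    by (simp add: \<omega>(2))
  have y'_orth: "orthonormal_family 2
      (\<lambda>j. vec_cnj (?y ((j + 1) mod 2)) /\<^sub>R norm (?y ((j + 1) mod 2)))"
    by (rule orthonormal_family_swap[OF y_orth])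
  have contr: "contract (\<eta> *s second_ent a b c d) (?y ((j + 1) mod 2)) = cmod d *\<^sub>R ?z j"
    if "j < 2" for j
  proof -
    have "contract (\<eta> *s second_ent a b c d) (?y ((j + 1) mod 2))
        = \<eta> *s contract (second_ent a b c d) (?y ((j + 1) mod 2))"
      by (simp add: contract_def vec_eq_iff sum_distrib_left mult.assoc)
    also have "\<dots> = (\<eta> * - cnj d) *s ?z j"
      by (simp only: contract_second_ent[OF nonzero ab cd that] vector_smult_assoc)
    also have "\<dots> = cmod d *\<^sub>R ?z j"
      unfolding \<eta>(2) by (simp add: vec_eq_iff scaleR_conv_of_real[where ?'a=complex])
    finally show ?thesis .
  qed
  have "schmidt_decomposition 2 ((\<eta> / \<omega>) *s ppeE) ?\<kappa>
        (\<lambda>j. ?z j /\<^sub>R norm (?z j))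
        (\<lambda>j. vec_cnj (?y ((j + 1) mod 2)) /\<^sub>R norm (?y ((j + 1) mod 2)))"
    unfolding schmidt_decomposition_def rephased
  proof (intro conjI allI impI)
    show "0 \<le> ?\<kappa> j" for j
      using kappa_pos[OF nonzero ab cd] by (rule less_imp_le)
    show "orthonormal_family 2 (\<lambda>j. ?z j /\<^sub>R norm (?z j))"
      by (intro orthonormal_family_normalizedI z_vec_nonzero[OF nonzero ab cd]
          z_vec_orthogonal[OF nonzero ab cd])
    show "\<eta> *s second_ent a b c d = (\<Sum>j<2. ?\<kappa> j *\<^sub>R ((?z j /\<^sub>R norm (?z j)) \<otimes>
        (vec_cnj (?y ((j + 1) mod 2)) /\<^sub>R norm (?y ((j + 1) mod 2)))))"
      by (rule schmidt_sum_eqI[OF y'_orth contr norm_z_vec[OF nonzero ab cd], symmetric])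
        (simp_all add: z_vec_nonzero[OF nonzero ab cd] y_vec_nonzero[OF nonzero ab cd])
  qed (rule y'_orth)
  moreover have "cmod (\<eta> / \<omega>) = 1" by (simp add: norm_divide \<eta>(1) \<omega>(1))
  ultimately show ?thesis by blast
qed

end
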